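(* There exist functions which are right Baire two compositors but not right Baire one compositors. Namely, the function $f = \chi_{\mathbb{R} \setminus \mathbb{Q}} : \mathbb{R} \to \mathbb{R}$ is a right Baire two compositor but is not a right Baire one compositor.
   Context: A function $\mathbb{R} \to \mathbb{R}$ is of Baire class one if it is the pointwise limit of a sequence of continuous functions $\mathbb{R}\to\mathbb{R}$, and of Baire class two if it is the pointwise limit of a sequence of functions of Baire class one. For $n \in \{1,2\}$, a function $f: \mathbb{R}\to\mathbb{R}$ is a right Baire $n$ compositor if $g \circ f$ is of Baire class $n$ for every $g: \mathbb{R}\to\mathbb{R}$ of Baire class $n$. $\chi_A$ denotes the characteristic function of $A$. *)

theory Defs
  imports "HOL-Analysis.Analysis"
begin

(* Class 0 consists of the continuous functions, so classes 1 and 2 are the usual ones. *)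
primrec baire_class :: "nat \<Rightarrow> (real \<Rightarrow> real) \<Rightarrow> bool" where
  "baire_class 0 f \<longleftrightarrow> continuous_on UNIV f"
| "baire_class (Suc n) f \<longleftrightarrow>
     (\<exists>F :: nat \<Rightarrow> real \<Rightarrow> real. (\<forall>k. baire_class n (F k)) \<and> (\<forall>x. (\<lambda>k. F k x) \<longlonglongrightarrow> f x))"

definition right_baire_compositor :: "nat \<Rightarrow> (real \<Rightarrow> real) \<Rightarrow> bool" where
  "right_baire_compositor n f \<longleftrightarrow>
     (\<forall>g :: real \<Rightarrow> real. baire_class n g \<longrightarrow> baire_class n (g \<circ> f))"

end

(* The indicator of the irrationals is the limit of the indicators of the open sets
   R - {q_0, ..., q_k}, where (q_n) enumerates the rationals, and these are of Baire class one;
   composing any g with it only gives an affine image of it. It is not of Baire class one itself, since by Baire's theorem a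
   function of that class cannot take values at most a and values at least b > a on dense sets;
   as the identity is of Baire class one, it is not a right Baire one compositor. *)
theory Submission
  imports Defs
begin

lemma baire_class_affine:
  assumes "baire_class n f"
  shows "baire_class n (\<lambda>x. c + d * f x)"
  using assms
proof (induction n arbitrary: f)
  case 0
  then show ?case by (auto intro!: continuous_intros)
next
  case (Suc n)
  then obtain F where F: "\<And>k. baire_class n (F k)" "\<And>x. (\<lambda>k. F k x) \<longlonglongrightarrow> f x"
    by auto
  have "baire_class n (\<lambda>x. c + d * F k x)" for k
    using Suc.IH F(1) by blast
  moreover have "(\<lambda>k. c + d * F k x) \<longlonglongrightarrow> c + d * f x" for x
    by (intro tendsto_intros F(2))
  ultimately show ?case
    by (auto intro!: exI[of _ "\<lambda>k x. c + d * F k x"])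
qed

lemma baire_class_SucI:
  assumes "\<And>k. baire_class n (F k)" "\<And>x. (\<lambda>k. F k x) \<longlonglongrightarrow> f x"
  shows "baire_class (Suc n) f"
  using assms by auto

lemma baire_class_Suc_mono:
  assumes "baire_class n f"
  shows "baire_class (Suc n) f"
  using assms by (intro baire_class_SucI[where F = "\<lambda>_. f"]) auto

text \<open>An indicator takes only the values 0 and 1, so \<open>g \<circ> indicator A\<close>
  depends on \<open>g\<close> only through \<open>g 0\<close> and \<open>g 1\<close> and is an
  affine image of the indicator.\<close>

lemma right_baire_compositor_indicator:
  assumes "baire_class n (indicator A)"
  shows "right_baire_compositor n (indicator A)"
  unfolding right_baire_compositor_def
proof (intro allI impI)
  fix g :: "real \<Rightarrow> real"
  have "g \<circ> indicator A = (\<lambda>x. g 0 + (g 1 - g 0) * indicator A x)"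
    by (auto simp: indicator_def)
  then show "baire_class n (g \<circ> indicator A)"
    using baire_class_affine[OF assms] by simp
qed

text \<open>Multiples of the distance to the complement, cut off at 1, are continuous, vanish off
  \<open>U\<close> and eventually equal 1 at each point of \<open>U\<close>.\<close>

lemma baire_class_1_indicator_open:
  assumes "open (U :: real set)"
  shows "baire_class 1 (indicator U)"
proof (cases "U = UNIV")
  \<comment> \<open>The whole line is treated apart because \<open>infdist\<close> to the empty set
    is 0 by convention, which would make every approximant vanish.\<close>
  case True
  then have "indicator U = (\<lambda>_::real. 1::real)"
    by auto
  then show ?thesis
    using baire_class_Suc_mono[of 0 "\<lambda>_. 1"] by simp
next
  case False
  then have ne: "- U \<noteq> {}" and cl: "closed (- U)"
    using assms by auto
  let ?F = "\<lambda>k x. min 1 (real k * infdist x (- U))"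
  have lim: "(\<lambda>k. ?F k x) \<longlonglongrightarrow> indicator U x" for x
  proof (cases "x \<in> U")
    case True
    then have pos: "infdist x (- U) > 0"
      using in_closed_iff_infdist_zero[OF cl ne, of x] infdist_nonneg[of x "- U"] by simp
    have "\<forall>\<^sub>F k in sequentially. ?F k x = 1"
    proof (rule eventually_sequentiallyI)
      fix k assume "k \<ge> nat \<lceil>1 / infdist x (- U)\<rceil>"
      then have "1 / infdist x (- U) \<le> real k"
        by linarith
      then show "?F k x = 1"
        using pos by (simp add: field_simps)
    qed
    then show ?thesis
      using True by (simp add: tendsto_eventually)
  next
    case False
    then show ?thesis by simp
  qed
  show ?thesis
    unfolding One_nat_def
  proof (rule baire_class_SucI[where F = ?F])
    show "baire_class 0 (?F k)" for k
      unfolding baire_class.simps(1) by (intro continuous_intros)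
  qed (rule lim)
qed

lemma baire_class_2_indicator_compl_countable:
  assumes "countable (A :: real set)"
  shows "baire_class 2 (indicator (- A))"
\<comment> \<open>\<open>from_nat_into A\<close> takes its values in \<open>A\<close> only when
  \<open>A\<close> is nonempty.\<close>
proof (cases "A = {}")
  case True
  then have "baire_class (Suc 1) (indicator (- A))"
    by (intro baire_class_Suc_mono baire_class_1_indicator_open) simp
  then show ?thesis
    by (simp only: numeral_2_eq_2 One_nat_def)
next
  case False
  let ?q = "from_nat_into A"
  let ?F = "\<lambda>k. indicator (- ?q ` {..k}) :: real \<Rightarrow> real"
  have "baire_class 1 (?F k)" for k
    by (intro baire_class_1_indicator_open open_Compl finite_imp_closed) simp
  moreover have "(\<lambda>k. ?F k x) \<longlonglongrightarrow> indicator (- A) x" for x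
  proof (cases "x \<in> A")
    case True
    then obtain n where "?q n = x"
      using from_nat_into_surj[OF assms] by blast
    then have "\<forall>\<^sub>F k in sequentially. ?F k x = 0"
      by (intro eventually_sequentiallyI[of n]) auto
    then show ?thesis
      using True by (simp add: tendsto_eventually)
  next
    case x: False
    then have "?F k x = 1" for k
      using from_nat_into[OF False] by (auto simp: indicator_def)
    then show ?thesis
      using x by simp
  qed
  ultimately have "baire_class (Suc 1) (indicator (- A))"
    by (rule baire_class_SucI)
  then show ?thesis
    by (simp only: numeral_2_eq_2 One_nat_def)
qed

text \<open>This is Baire's theorem in terms of closed covers: if all interiors were empty, the
  complements would be countably many dense open sets with empty intersection.\<close>

lemma countable_closed_cover_interior:
  fixes \<G> :: "'a :: {real_normed_vector, heine_borel} set set"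
  assumes "countable \<G>" "\<And>T. T \<in> \<G> \<Longrightarrow> closed T" "\<Union>\<G> = UNIV"
  obtains T where "T \<in> \<G>" "interior T \<noteq> {}"
proof -
  have "\<exists>T\<in>\<G>. interior T \<noteq> {}"
  proof (rule ccontr)
    assume "\<not> ?thesis"
    then have "UNIV \<subseteq> closure (\<Inter> (uminus ` \<G>))"
      using assms by (intro Baire) (auto simp: closure_complement)
    moreover have "\<Inter> (uminus ` \<G>) = {}"
      using assms(3) by auto
    ultimately show False by simp
  qed
  then show thesis using that by blast
qed

text \<open>The closed sets on which a tail of the approximating sequence stays below
  \<open>d\<close>, or above \<open>c\<close>, cover the line. By Baire's theorem one of them has
  interior points, and on it \<open>f\<close> stays below \<open>b\<close> or above
  \<open>a\<close>, against density.\<close>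

lemma not_baire_class_1_if_dense_gap:
  assumes "a < b" "closure {x. f x \<le> a} = UNIV" "closure {x. b \<le> f x} = UNIV"
  shows "\<not> baire_class 1 f"
proof
  assume "baire_class 1 f"
  then obtain F where cont: "\<And>k. continuous_on UNIV (F k)"
    and lim: "\<And>x. (\<lambda>k. F k x) \<longlonglongrightarrow> f x"
    by auto
  \<comment> \<open>Two overlapping thresholds are taken so that each point satisfies
    \<open>f x < d\<close> or \<open>c < f x\<close>; either strict inequality passes to a tail of
    the sequence.\<close>
  obtain c d where c: "a < c" "c < d" "d < b"
    using dense[OF assms(1)] dense by blast
  let ?A = "\<lambda>n. \<Inter>k\<in>{n..}. {x. F k x \<le> d}"
  let ?B = "\<lambda>n. \<Inter>k\<in>{n..}. {x. c \<le> F k x}"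
  have closed: "closed (?A n)" "closed (?B n)" for n
    by (auto intro!: closed_INT closed_Collect_le cont)
  have cover: "x \<in> \<Union> (range ?A \<union> range ?B)" for x
  proof (cases "f x < d")
    case True
    then have "\<forall>\<^sub>F k in sequentially. F k x < d"
      using lim order_tendstoD(2) by blast
    then obtain n where "\<And>k. k \<ge> n \<Longrightarrow> F k x < d"
      by (auto simp: eventually_sequentially)
    then have "x \<in> ?A n"
      by (auto intro: less_imp_le)
    then show ?thesis by blast
  next
    case False
    then have "\<forall>\<^sub>F k in sequentially. c < F k x"
      using c(2) by (intro order_tendstoD(1)[OF lim]) simp
    then obtain n where "\<And>k. k \<ge> n \<Longrightarrow> c < F k x"
      by (auto simp: eventually_sequentially)
    then have "x \<in> ?B n"
      by (auto intro: less_imp_le)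
    then show ?thesis by blast
  qed
  obtain T where T: "T \<in> range ?A \<union> range ?B" "interior T \<noteq> {}"
  proof (rule countable_closed_cover_interior[of "range ?A \<union> range ?B"])
    show "\<Union> (range ?A \<union> range ?B) = UNIV"
      using cover by blast
  qed (use closed in auto)
  \<comment> \<open>A dense set meets the nonempty open set \<open>interior T\<close>.\<close>
  have meets: "S \<inter> T \<noteq> {}" if "closure S = UNIV" for S
    using open_Int_closure_eq_empty[of "interior T" S] that T(2) interior_subset[of T] by auto
  from T(1) show False
  proof
    assume "T \<in> range ?A"
    then have "f x \<le> d" if "x \<in> T" for x
      using that by (auto intro!: LIMSEQ_le_const2[OF lim])
    then show False
      using meets[OF assms(3)] c by fastforce
  next
    assume "T \<in> range ?B"
    then have "c \<le> f x" if "x \<in> T" for x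
      using that by (auto intro!: LIMSEQ_le_const[OF lim])
    then show False
      using meets[OF assms(2)] c by fastforce
  qed
qed

text \<open>A nonempty open set of reals is uncountable, so none lies inside the rationals.\<close>

lemma closure_irrationals: "closure (- \<rat>) = (UNIV :: real set)"
proof -
  have "interior \<rat> = ({} :: real set)"
    using open_minus_countable[OF countable_rat _ open_interior] interior_subset by blast
  then show ?thesis
    by (simp add: closure_complement)
qed

theorem mainTheorem5:
  shows "(\<exists>f :: real \<Rightarrow> real. right_baire_compositor 2 f \<and> \<not> right_baire_compositor 1 f) \<and>
    right_baire_compositor 2 (indicator (UNIV - \<rat>) :: real \<Rightarrow> real) \<and>
    \<not> right_baire_compositor 1 (indicator (UNIV - \<rat>) :: real \<Rightarrow> real)"
proof -
  let ?f = "indicator (UNIV - \<rat>) :: real \<Rightarrow> real"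
  have "right_baire_compositor 2 ?f"
    using right_baire_compositor_indicator[OF
        baire_class_2_indicator_compl_countable[OF countable_rat]]
    by (simp add: Compl_eq_Diff_UNIV)
  moreover have "\<not> right_baire_compositor 1 ?f"
  proof
    assume "right_baire_compositor 1 ?f"
    moreover have "baire_class 1 id"
      using baire_class_Suc_mono[of 0 id] by (simp add: id_def)
    ultimately have "baire_class 1 (id \<circ> ?f)"
      unfolding right_baire_compositor_def by blast
    then have "baire_class 1 ?f"
      unfolding id_comp .
    \<comment> \<open>The gap is between 0 and 1, and both level sets are dense.\<close>
    moreover have "{x. ?f x \<le> 0} = \<rat>" "{x. 1 \<le> ?f x} = - \<rat>"
      by (auto simp: indicator_def)
    then have "closure {x. ?f x \<le> 0} = UNIV" "closure {x. 1 \<le> ?f x} = UNIV"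
      by (simp_all only: Rats_closure_real closure_irrationals)
    ultimately show False
      using not_baire_class_1_if_dense_gap[OF zero_less_one] by blast
  qed
  ultimately show ?thesis by blast
qed

end
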